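(* Let $\rho>1$ and set $n_k=2^k-1$ $(k\in\mathbb{N})$. Define $\gamma$ on $\mathbb{Z}^+$ by $$\gamma_0=1,\quad\gamma_1=\rho+1,\quad\gamma_2=(\rho+1)^2,\quad\gamma_3=\rho+1,$$ and recursively $$\gamma_j=(\rho+1)\gamma_{j-n_k}\quad(n_k\le j<n_{k+1},\ k\ge2),$$ and extend $\gamma$ to $\mathbb{Z}$ by $\gamma_{-n}=(\rho+1)^n\gamma_n$ $(n\in\mathbb{N})$. Let $\omega$ be the weight on $\mathbb{Z}$ given by $\omega_n=\rho^{|n|}\gamma_n$ $(n\in\mathbb{Z})$. Then the augmentation ideal $\ell^1_0(\mathbb{Z},\omega)$ of $\ell^1(\mathbb{Z},\omega)$ fails to be finitely-generated, despite corresponding to an interior point (the point $1$) of the character space of $\ell^1(\mathbb{Z},\omega)$.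
   Context: $\mathbb{Z}^+=\{0,1,2,\ldots\}$ and $\mathbb{N}=\{1,2,\ldots\}$. A weight on $\mathbb{Z}$ is a function $\omega:\mathbb{Z}\to[1,\infty)$, written $n\mapsto\omega_n$, with $\omega_{m+n}\le\omega_m\omega_n$ and $\omega_0=1$. $\ell^1(\mathbb{Z},\omega)$ is the set of $f:\mathbb{Z}\to\mathbb{C}$ with $\|f\|_\omega=\sum_n|f(n)|\omega_n<\infty$, a commutative unital Banach algebra under convolution; $\delta_n$ is the point mass at $n$. Its augmentation ideal is $\ell^1_0(\mathbb{Z},\omega)=\{f:\sum_n f(n)=0\}$. The character space of $\ell^1(\mathbb{Z},\omega)$ is identified, via $\varphi\mapsto\varphi(\delta_1)$, with the annulus $\{z\in\mathbb{C}:\rho_1\le|z|\le\rho_2\}$, where $\rho_1=\lim_{n\to\infty}\omega_{-n}^{-1/n}$ and $\rho_2=\lim_{n\to\infty}\omega_n^{1/n}$. The augmentation ideal is the kernel of the character corresponding to $z=1$; "interior point" means interior point of this annulus as a subset of $\mathbb{C}$, i.e. $\rho_1<1<\rho_2$. An ideal $I$ of a commutative unital algebra $A$ is finitely-generated if there exist $n\in\mathbb{N}$ and $x_1,\ldots,x_n\in A$ with $I=Ax_1+\cdots+Ax_n$ (purely algebraically, no closure is taken). *)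

theory Defs
  imports "HOL-Analysis.Analysis"
begin

definition is_weight :: "(int \<Rightarrow> real) \<Rightarrow> bool" where
  "is_weight \<omega> \<longleftrightarrow>
     (\<forall>n. 1 \<le> \<omega> n) \<and> (\<forall>m n. \<omega> (m + n) \<le> \<omega> m * \<omega> n) \<and> \<omega> 0 = 1"

definition ell1 :: "(int \<Rightarrow> real) \<Rightarrow> (int \<Rightarrow> complex) set" where
  "ell1 \<omega> = {f. (\<lambda>n. cmod (f n) * \<omega> n) summable_on UNIV}"

definition conv :: "(int \<Rightarrow> complex) \<Rightarrow> (int \<Rightarrow> complex) \<Rightarrow> int \<Rightarrow> complex" where
  "conv f g = (\<lambda>n. \<Sum>\<^sub>\<infinity>m\<in>UNIV. f m * g (n - m))"

definition point_mass :: "int \<Rightarrow> int \<Rightarrow> complex" where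
  "point_mass n = (\<lambda>m. if m = n then 1 else 0)"

definition augmentation_ideal :: "(int \<Rightarrow> real) \<Rightarrow> (int \<Rightarrow> complex) set" where
  "augmentation_ideal \<omega> = {f \<in> ell1 \<omega>. (\<Sum>\<^sub>\<infinity>n\<in>UNIV. f n) = 0}"

text \<open>Nonzero multiplicative linear functionals. No continuity is imposed (it is automatic on a
  Banach algebra). Extensionality makes a functional on the subset \<open>ell1 \<omega>\<close> a
  unique HOL function.\<close>

definition character_space ::
  "(int \<Rightarrow> real) \<Rightarrow> ((int \<Rightarrow> complex) \<Rightarrow> complex) set" where
  "character_space \<omega> =
     {\<phi> \<in> extensional (ell1 \<omega>).
        (\<forall>f \<in> ell1 \<omega>. \<forall>g \<in> ell1 \<omega>. \<phi> (\<lambda>n. f n + g n) = \<phi> f + \<phi> g) \<and>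
        (\<forall>c. \<forall>f \<in> ell1 \<omega>. \<phi> (\<lambda>n. c * f n) = c * \<phi> f) \<and>
        (\<forall>f \<in> ell1 \<omega>. \<forall>g \<in> ell1 \<omega>. \<phi> (conv f g) = \<phi> f * \<phi> g) \<and>
        (\<exists>f \<in> ell1 \<omega>. \<phi> f \<noteq> 0)}"

text \<open>The annulus with which the character space is identified via
  \<open>\<phi> \<mapsto> \<phi> (point_mass 1)\<close>. Its radii are given as arguments.\<close>

definition annulus :: "real \<Rightarrow> real \<Rightarrow> complex set" where
  "annulus \<rho>\<^sub>1 \<rho>\<^sub>2 = {z. \<rho>\<^sub>1 \<le> cmod z \<and> cmod z \<le> \<rho>\<^sub>2}"

text \<open>\<open>I = A x\<^sub>1 + \<dots> + A x\<^sub>n\<close> inside the algebra \<open>A = ell1 \<omega>\<close>, with no closure taken.\<close>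

definition finitely_generated_ideal ::
  "(int \<Rightarrow> real) \<Rightarrow> (int \<Rightarrow> complex) set \<Rightarrow> bool" where
  "finitely_generated_ideal \<omega> I \<longleftrightarrow>
     (\<exists>n\<ge>1. \<exists>x :: nat \<Rightarrow> int \<Rightarrow> complex.
        (\<forall>i\<in>{1..n}. x i \<in> ell1 \<omega>) \<and>
        I = {(\<lambda>m. \<Sum>i=1..n. conv (a i) (x i) m) | a. \<forall>i\<in>{1..n}. a i \<in> ell1 \<omega>})"

end

theory Submission
  imports Defs "HOL-Library.Discrete_Functions" "HOL-Real_Asymp.Real_Asymp"
begin

text \<open>
  Call the numbers \<open>2 ^ k - 1\<close> with \<open>k \<ge> 1\<close> Mersenne numbers. The recursion for \<open>\<gamma>\<close> removes from
  \<open>j\<close> the largest Mersenne number that fits and pays a factor \<open>\<rho> + 1\<close> for it, so for \<open>j \<ge> 0\<close> the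
  value \<open>\<gamma> j\<close> is \<open>(\<rho> + 1) ^ d j\<close>, where \<open>d j\<close> is the number of summands in the greedy
  representation of \<open>j\<close> by Mersenne numbers. Two facts about this length make \<open>\<omega>\<close> a weight: \<open>d\<close> is
  subadditive (\<open>mersenne_length_subadditive\<close>), and lowering the argument by one raises \<open>d\<close> by at most
  one (\<open>mersenne_length_pred\<close>), which the extra factor \<open>(\<rho> + 1) ^ n\<close> on the negative side absorbs.
  Since \<open>d\<close> grows only logarithmically, the radii are \<open>1 / (\<rho> * (\<rho> + 1)) < 1 < \<rho>\<close>; each point \<open>z\<close>
  of the annulus satisfies \<open>\<bar>z\<bar> ^ n \<le> \<omega> n\<close>, so evaluating the Laurent series at \<open>z\<close> is a character.

  The obstruction to finite generation is a dip of the weight: \<open>d\<close> is \<open>1\<close> at a Mersenne number \<open>p\<close>,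
  but \<open>d (p - u) = u + 1\<close> for small \<open>u\<close>, so \<open>\<omega> (p - u)\<close> exceeds \<open>\<omega> p\<close> by the unbounded factor
  \<open>((\<rho> + 1) / \<rho>) ^ u\<close>. Dividing \<open>f\<close> in the augmentation ideal by \<open>\<delta>\<^sub>1 - \<delta>\<^sub>0\<close> produces the tail sums
  \<open>T\<^sub>m f = (\<Sum>s>m. f s)\<close>, and these satisfy \<open>T\<^sub>m (a * x) = (\<Sum>j. a j * T\<^sub>m\<^sub>-\<^sub>j x)\<close>. For an arbitrary element
  \<open>f\<close> of the ideal the best bound for \<open>T\<^sub>m f\<close> with \<open>m = p - u\<close> is of order \<open>1 / \<omega> p\<close>. In a multiple
  \<open>a * x\<close>, however, mass of \<open>a\<close> has to sit near \<open>m\<close>, where it costs \<open>\<omega> m\<close>, much more than \<open>\<omega> p\<close>;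
  so \<open>\<omega> p * \<bar>T\<^sub>m (a * x)\<bar>\<close> is at most \<open>\<epsilon> * \<parallel>a\<parallel>\<close>, where \<open>\<epsilon>\<close> depends on \<open>x\<close> and \<open>p\<close> only and tends to
  \<open>0\<close> along \<open>p\<close> (\<open>tail_sum_small\<close>). With finitely many generators one sequence \<open>\<epsilon>\<close> serves the whole
  ideal, and a lacunary series of elements \<open>\<delta>\<^sub>p - \<delta>\<^sub>0\<close> has tails that decay more slowly than \<open>\<epsilon>\<close>
  (\<open>exists_element_with_large_tails\<close>): its coefficients are nonnegative apart from the one at \<open>0\<close>, so
  nothing cancels in the tails.
\<close>

section \<open>Greedy representations by Mersenne numbers\<close>

function mersenne_length :: "nat \<Rightarrow> nat" where
  "mersenne_length j =
     (if j = 0 then 0 else Suc (mersenne_length (j - (2 ^ floor_log (Suc j) - 1))))"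
  by auto
termination
proof (relation "Wellfounded.measure id")
  fix j :: nat
  assume "j \<noteq> 0"
  then have "floor_log (Suc j) \<ge> 1"
    using floor_log_le_iff[of 2 "Suc j"] floor_log_twice[of 1] by simp
  then have "(2::nat) ^ 1 \<le> 2 ^ floor_log (Suc j)"
    by (intro power_increasing) auto
  then show "(j - (2 ^ floor_log (Suc j) - 1), j) \<in> Wellfounded.measure id"
    using \<open>j \<noteq> 0\<close> by simp
qed simp

declare mersenne_length.simps [simp del]

lemma mersenne_length_0 [simp]: "mersenne_length 0 = 0"
  by (simp add: mersenne_length.simps)

lemma mersenne_length_step:
  assumes "1 \<le> k" "b < 2 ^ k"
  shows "mersenne_length (b + (2 ^ k - 1)) = Suc (mersenne_length b)"
proof -
  have "(2::nat) ^ 1 \<le> 2 ^ k"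
    using assms by (intro power_increasing) auto
  moreover have "floor_log (Suc (b + (2 ^ k - 1))) = k"
    using assms by (intro floor_log_eqI) auto
  ultimately show ?thesis
    using mersenne_length.simps[of "b + (2 ^ k - 1)"] by simp
qed

lemma mersenne_decomp:
  fixes j :: nat
  assumes "0 < j"
  obtains k b where "1 \<le> k" "b < 2 ^ k" "j = b + (2 ^ k - 1)"
proof -
  define k where "k = floor_log (Suc j)"
  have 1: "1 \<le> k"
    using floor_log_le_iff[of 2 "Suc j"] floor_log_twice[of 1] assms by (simp add: k_def)
  have 2: "2 ^ k \<le> Suc j" "Suc j < 2 * 2 ^ k"
    using floor_log_exp2_le[of "Suc j"] floor_log_exp2_gt[of "Suc j"] by (simp_all add: k_def)
  show ?thesis
    by (rule that[of k "j - (2 ^ k - 1)"]) (use 1 2 in auto)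
qed

lemma mersenne_length_mersenne:
  assumes "1 \<le> k"
  shows "mersenne_length (2 ^ k - 1) = 1"
  using mersenne_length_step[OF assms, of 0] by simp

lemma mersenne_length_pos: "0 < j \<Longrightarrow> 0 < mersenne_length j"
  by (subst mersenne_length.simps) simp

text \<open>Only the last summand of the representation has to change: \<open>2 ^ (l + 1) - 2\<close> is twice the Mersenne
  number \<open>2 ^ l - 1\<close>, so lowering a summand by one replaces it by two (or, for the summand \<open>1\<close>,
  removes it).\<close>

lemma mersenne_length_pred: "mersenne_length (j - 1) \<le> Suc (mersenne_length j)"
proof (induction j rule: less_induct)
  case (less j)
  show ?case
  proof (cases "j = 0")
    case False
    then obtain k b where kb: "1 \<le> k" "b < 2 ^ k" "j = b + (2 ^ k - 1)"
      using mersenne_decomp by blast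
    show ?thesis
    proof (cases "b = 0")
      case True
      show ?thesis
      proof (cases "k = 1")
        case True
        then show ?thesis using kb \<open>b = 0\<close> by simp
      next
        case False
        define l where "l = k - 1"
        have l: "1 \<le> l" "k = Suc l" using False kb by (auto simp: l_def)
        have "(2::nat) ^ l \<ge> 1" by simp
        then have "j - 1 = (2 ^ l - 1) + (2 ^ l - 1)"
          using kb \<open>b = 0\<close> l by simp
        moreover have "mersenne_length \<dots> = Suc (mersenne_length (2 ^ l - 1))"
          using l by (intro mersenne_length_step) auto
        ultimately show ?thesis
          using mersenne_length_mersenne[OF l(1)] mersenne_length_pos[of j] \<open>j \<noteq> 0\<close> by simp
      qed
    next
      case False
      have "(2::nat) ^ 1 \<le> 2 ^ k" using kb by (intro power_increasing) auto
      then have "b < j" using kb by simp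
      have "j - 1 = (b - 1) + (2 ^ k - 1)" using kb False by simp
      then have "mersenne_length (j - 1) = Suc (mersenne_length (b - 1))"
        using mersenne_length_step[of k "b - 1"] kb by simp
      moreover have "mersenne_length j = Suc (mersenne_length b)"
        using mersenne_length_step kb by simp
      ultimately show ?thesis using less.IH[OF \<open>b < j\<close>] by simp
    qed
  qed simp
qed

lemma mersenne_length_diff: "mersenne_length (j - t) \<le> mersenne_length j + t"
proof (induction t)
  case (Suc t)
  have "mersenne_length (j - Suc t) \<le> Suc (mersenne_length (j - t))"
    using mersenne_length_pred[of "j - t"] by simp
  then show ?case using Suc by simp
qed simp

text \<open>This is the case of \<open>mersenne_length_add_mersenne\<close> in which adding \<open>2 ^ k - 1\<close> to
  \<open>b + (2 ^ l - 1)\<close> produces a carry, that is, makes \<open>2 ^ (l + 1) - 1\<close> the new leading summand. There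
  \<open>t = 1\<close>; the parameter \<open>t\<close> is what makes the induction on \<open>l\<close> go through, because removing the
  leading summand of \<open>b\<close> lowers \<open>l\<close> by one and raises \<open>t\<close> by one, while the length of \<open>b\<close> drops by
  one. At \<open>l = k\<close> the claim is \<open>mersenne_length_diff\<close>.\<close>

lemma mersenne_length_exchange:
  assumes "1 \<le> k" "k \<le> l" "b < 2 ^ l" "2 ^ l + t \<le> b + 2 ^ k"
  shows "mersenne_length (b + 2 ^ k - (2 ^ l + t)) \<le> mersenne_length b + t"
  using assms(2-4)
proof (induction l arbitrary: b t rule: dec_induct)
  case base
  then show ?case using mersenne_length_diff[of b t] by simp
next
  case (step l)
  have pw: "(2::nat) ^ k \<le> 2 ^ l" using step.hyps by (intro power_increasing) auto
  show ?case
  proof (cases "b = 2 ^ Suc l - 1")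
    case True
    have "b + 2 ^ k - (2 ^ Suc l + t) = (2 ^ k - 1) - t" using True by simp
    then show ?thesis
      using mersenne_length_diff[of "2 ^ k - 1" t] mersenne_length_mersenne[OF assms(1)]
        mersenne_length_mersenne[of "Suc l"] True by simp
  next
    case False
    define c where "c = b - (2 ^ l - 1)"
    have "2 ^ l - 1 \<le> b"
      using step.prems(2) pw unfolding power_Suc by linarith
    then have c: "b = c + (2 ^ l - 1)"
      by (simp add: c_def)
    moreover have "b < 2 ^ Suc l - 1"
      using step.prems(1) False by simp
    ultimately have c': "c < 2 ^ l"
      by simp
    have "mersenne_length b = Suc (mersenne_length c)"
      using mersenne_length_step[of l c] c c' step.hyps assms(1) by simp
    moreover have "b + 2 ^ k - (2 ^ Suc l + t) = c + 2 ^ k - (2 ^ l + Suc t)"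
      using c one_le_power[of "2::nat" l] unfolding power_Suc by linarith
    moreover have "mersenne_length (c + 2 ^ k - (2 ^ l + Suc t)) \<le> mersenne_length c + Suc t"
      using c c' step.prems by (intro step.IH) auto
    ultimately show ?thesis by simp
  qed
qed

text \<open>If \<open>a < 2 ^ k\<close>, then \<open>2 ^ k - 1\<close> is the leading summand of the sum. Otherwise either the leading
  summand of \<open>a\<close> stays in place and induction applies to the rest, or there is a carry.\<close>

lemma mersenne_length_add_mersenne:
  assumes "1 \<le> k"
  shows "mersenne_length (a + (2 ^ k - 1)) \<le> Suc (mersenne_length a)"
proof (induction a rule: less_induct)
  case (less a)
  show ?case
  proof (cases "a < 2 ^ k")
    case True
    then show ?thesis using mersenne_length_step[OF assms] by simp
  next
    case False
    then have "0 < a" by (metis gr0I zero_less_power zero_less_numeral)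
    then obtain l b where lb: "1 \<le> l" "b < 2 ^ l" "a = b + (2 ^ l - 1)"
      using mersenne_decomp by blast
    have "(2::nat) ^ 1 \<le> 2 ^ l" using lb by (intro power_increasing) auto
    then have "b < a" using lb by simp
    have "(2::nat) ^ k < 2 ^ Suc l" using False lb by simp
    then have "k < Suc l" using power_less_imp_less_exp[of "2::nat" k "Suc l"] by simp
    then have kl: "k \<le> l" by simp
    then have pw: "(2::nat) ^ k \<le> 2 ^ l" by (intro power_increasing) auto
    have da: "mersenne_length a = Suc (mersenne_length b)"
      using mersenne_length_step lb by simp
    show ?thesis
    proof (cases "b + (2 ^ k - 1) < 2 ^ l")
      case True
      have "mersenne_length (a + (2 ^ k - 1)) = Suc (mersenne_length (b + (2 ^ k - 1)))"
        using mersenne_length_step[OF lb(1) True] by (simp only: lb(3) ac_simps)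
      then show ?thesis using less.IH[OF \<open>b < a\<close>] da by simp
    next
      case False
      define c where "c = b + 2 ^ k - (2 ^ l + 1)"
      have "c < 2 ^ Suc l" "a + (2 ^ k - 1) = c + (2 ^ Suc l - 1)"
        using False lb(2,3) pw one_le_power[of "2::nat" l] one_le_power[of "2::nat" k]
        unfolding c_def power_Suc by linarith+
      then have "mersenne_length (a + (2 ^ k - 1)) = Suc (mersenne_length c)"
        using mersenne_length_step[of "Suc l" c] by simp
      moreover have "mersenne_length c \<le> mersenne_length b + 1"
        unfolding c_def using assms kl lb False by (intro mersenne_length_exchange) auto
      ultimately show ?thesis using da by simp
    qed
  qed
qed

text \<open>Together with the value \<open>1\<close> at Mersenne numbers this says that the greedy representation is a
  shortest one.\<close>

lemma mersenne_length_subadditive: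
  "mersenne_length (i + j) \<le> mersenne_length i + mersenne_length j"
proof (induction j arbitrary: i rule: less_induct)
  case (less j)
  show ?case
  proof (cases "j = 0")
    case False
    then obtain k b where kb: "1 \<le> k" "b < 2 ^ k" "j = b + (2 ^ k - 1)"
      using mersenne_decomp by blast
    have "(2::nat) ^ 1 \<le> 2 ^ k" using kb by (intro power_increasing) auto
    then have "b < j" using kb by simp
    have "mersenne_length (i + j) \<le> Suc (mersenne_length (i + b))"
      using mersenne_length_add_mersenne[OF kb(1), of "i + b"] by (simp only: kb(3) add.assoc)
    also have "\<dots> \<le> mersenne_length i + Suc (mersenne_length b)"
      using less.IH[OF \<open>b < j\<close>, of i] by simp
    also have "Suc (mersenne_length b) = mersenne_length j"
      using mersenne_length_step kb by simp
    finally show ?thesis .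
  qed simp
qed

text \<open>Since \<open>2 ^ (l + 1) - 1 - (u + 1) = (2 ^ l - 1 - u) + (2 ^ l - 1)\<close>, each step down from a Mersenne
  number adds one summand. This is the dip of the weight at Mersenne numbers.\<close>

lemma mersenne_length_before_mersenne:
  "u < k \<Longrightarrow> mersenne_length (2 ^ k - 1 - u) = Suc u"
proof (induction u arbitrary: k)
  case 0
  then show ?case using mersenne_length_mersenne[of k] by simp
next
  case (Suc u)
  define l where "l = k - 1"
  have l: "k = Suc l" "u < l" using Suc.prems by (auto simp: l_def)
  have "u < 2 ^ l" using l(2) less_exp[of l] by linarith
  then have "2 ^ k - 1 - Suc u = (2 ^ l - 1 - u) + (2 ^ l - 1)"
    using l by simp
  moreover have "mersenne_length \<dots> = Suc (mersenne_length (2 ^ l - 1 - u))"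
    using l \<open>u < 2 ^ l\<close> by (intro mersenne_length_step) auto
  ultimately show ?case using Suc.IH[OF l(2)] by simp
qed

lemma mersenne_length_bound: "b < 2 ^ k \<Longrightarrow> mersenne_length b \<le> Suc k"
proof (induction k arbitrary: b)
  case (Suc k)
  show ?case
  proof (cases "b < 2 ^ k")
    case True
    then show ?thesis using Suc.IH[of b] by simp
  next
    case False
    show ?thesis
    proof (cases "b = 2 ^ Suc k - 1")
      case True
      then show ?thesis using mersenne_length_mersenne[of "Suc k"] by simp
    next
      case b: False
      show ?thesis
      proof (cases "k = 0")
        case True
        then show ?thesis using Suc.prems b False by simp
      next
        case k: False
        define c where "c = b - (2 ^ k - 1)"
        have "b = c + (2 ^ k - 1)"
          using False by (simp add: c_def)
        moreover have "b < 2 ^ Suc k - 1"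
          using Suc.prems b by simp
        ultimately have c: "c < 2 ^ k" "b = c + (2 ^ k - 1)"
          by simp_all
        then have "mersenne_length b = Suc (mersenne_length c)"
          using mersenne_length_step[of k c] k by simp
        then show ?thesis using Suc.IH[OF c(1)] by simp
      qed
    qed
  qed
qed simp

lemma mersenne_length_le_log: "mersenne_length j \<le> log 2 (real (Suc j)) + 2"
proof -
  define k where "k = floor_log (Suc j)"
  have 2: "2 ^ k \<le> Suc j" "Suc j < 2 * 2 ^ k"
    using floor_log_exp2_le[of "Suc j"] floor_log_exp2_gt[of "Suc j"] by (simp_all add: k_def)
  have "mersenne_length j \<le> Suc (Suc k)"
    using 2 by (intro mersenne_length_bound) simp
  moreover have "real k \<le> log 2 (real (Suc j))"
    using 2(1) by (metis le_log2_of_power)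
  ultimately show ?thesis by linarith
qed

section \<open>Convolution and characters of weighted sequence spaces\<close>

text \<open>Absolute summability is meant below in the sense of infinite sums over filters of finite sets,
  that is, \<open>f abs_summable_on A\<close> says that the norms of \<open>f\<close> are summable on \<open>A\<close>.\<close>

no_notation Infinite_Set_Sum.abs_summable_on (infix "abs'_summable'_on" 50)

lemma is_weightD:
  assumes "is_weight \<omega>"
  shows "1 \<le> \<omega> n" "0 < \<omega> n" "\<omega> (m + n) \<le> \<omega> m * \<omega> n" "\<omega> 0 = 1"
  using assms less_le_trans[OF zero_less_one] by (auto simp: is_weight_def)

lemma ell1_dominated_abs_summable:
  assumes "f \<in> ell1 \<omega>" "\<And>n. cmod (c n) \<le> \<omega> n"
  shows "(\<lambda>n. c n * f n) abs_summable_on UNIV"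
proof (rule Infinite_Sum.abs_summable_on_comparison_test')
  show "(\<lambda>n. cmod (f n) * \<omega> n) summable_on UNIV"
    using assms(1) by (simp add: ell1_def)
  show "norm (c n * f n) \<le> cmod (f n) * \<omega> n" for n
    using mult_left_mono[OF assms(2)[of n] norm_ge_zero[of "f n"]]
    by (simp add: norm_mult mult.commute)
qed

lemma ell1_abs_summable:
  assumes "is_weight \<omega>" "f \<in> ell1 \<omega>"
  shows "f abs_summable_on UNIV"
  using ell1_dominated_abs_summable[OF assms(2), of "\<lambda>_. 1"] is_weightD(1)[OF assms(1)]
  by simp

text \<open>After the substitution \<open>p = s - j\<close> the double series is dominated by the product of the two norm
  series, by submultiplicativity of the weight. The factor \<open>c\<close> covers three uses: \<open>c = \<omega>\<close> for the norm
  of a convolution, \<open>c s = z powi s\<close> for characters, and the indicator of \<open>{m<..}\<close> for tail sums.\<close>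

lemma conv_double_abs_summable:
  assumes "is_weight \<omega>" "f \<in> ell1 \<omega>" "g \<in> ell1 \<omega>" "\<And>s. cmod (c s) \<le> \<omega> s"
  shows "(\<lambda>(s, j). c s * (f j * g (s - j))) abs_summable_on UNIV \<times> UNIV"
proof -
  let ?F = "\<lambda>n. cmod (f n) * \<omega> n" and ?G = "\<lambda>n. cmod (g n) * \<omega> n"
  have F: "?F summable_on UNIV" and G: "?G summable_on UNIV"
    using assms by (auto simp: ell1_def)
  have "(\<lambda>(j, p). ?F j * ?G p) abs_summable_on UNIV \<times> UNIV"
    using F G
    by (subst Infinite_Sum.abs_summable_on_Sigma_iff)
       (auto simp: abs_mult abs_of_pos[OF is_weightD(2)[OF assms(1)]] infsum_cmult_right'
          intro!: summable_on_cmult_right summable_on_cmult_left)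
  then have "(\<lambda>(j, p). ?F j * ?G p) summable_on UNIV"
    using abs_summable_summable by force
  moreover have "bij_betw (\<lambda>(s, j). (j, s - j)) UNIV (UNIV :: (int \<times> int) set)"
    by (rule bij_betwI[where g = "\<lambda>(j, p). (j + p, j)"]) auto
  ultimately have dom: "(\<lambda>x. case (case x of (s, j) \<Rightarrow> (j, s - j)) of (j, p) \<Rightarrow> ?F j * ?G p)
      summable_on UNIV"
    by (subst summable_on_reindex_bij_betw)
  have "cmod (c s) * (cmod (f j) * cmod (g (s - j)))
      \<le> (\<omega> j * \<omega> (s - j)) * (cmod (f j) * cmod (g (s - j)))" for s j
    using assms(4)[of s] is_weightD(3)[OF assms(1), of j "s - j"]
    by (intro mult_right_mono) auto
  then show ?thesis
    using dom
    by (intro Infinite_Sum.abs_summable_on_comparison_test'[OF dom[folded UNIV_Times_UNIV]])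
       (auto simp: norm_mult mult_ac)
qed

text \<open>Fubini for the functional \<open>f \<mapsto> (\<Sum>s. c s * f s)\<close> applied to a convolution.\<close>

lemma dominated_infsum_conv:
  assumes "is_weight \<omega>" "f \<in> ell1 \<omega>" "g \<in> ell1 \<omega>" "\<And>s. cmod (c s) \<le> \<omega> s"
  shows "(\<Sum>\<^sub>\<infinity>s. c s * conv f g s) = (\<Sum>\<^sub>\<infinity>j. f j * (\<Sum>\<^sub>\<infinity>p. c (j + p) * g p))"
proof -
  have sm: "(\<lambda>(s, j). c s * (f j * g (s - j))) summable_on UNIV \<times> UNIV"
    using conv_double_abs_summable[OF assms] by (rule abs_summable_summable)
  have "(\<Sum>\<^sub>\<infinity>s. c s * conv f g s) = (\<Sum>\<^sub>\<infinity>s. \<Sum>\<^sub>\<infinity>j. c s * (f j * g (s - j)))"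
    by (simp add: conv_def infsum_cmult_right')
  also have "\<dots> = (\<Sum>\<^sub>\<infinity>j. \<Sum>\<^sub>\<infinity>s. c s * (f j * g (s - j)))"
    using sm by (rule infsum_swap_banach)
  also have "\<dots> = (\<Sum>\<^sub>\<infinity>j. f j * (\<Sum>\<^sub>\<infinity>p. c (j + p) * g p))"
  proof (rule infsum_cong)
    fix j :: int
    have "bij_betw ((+) j) UNIV UNIV"
      by (rule bij_betwI[where g = "\<lambda>s. s - j"]) auto
    then have "(\<Sum>\<^sub>\<infinity>p. c (j + p) * (f j * g (j + p - j))) = (\<Sum>\<^sub>\<infinity>s. c s * (f j * g (s - j)))"
      by (rule infsum_reindex_bij_betw)
    then show "(\<Sum>\<^sub>\<infinity>s. c s * (f j * g (s - j))) = f j * (\<Sum>\<^sub>\<infinity>p. c (j + p) * g p)"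
      by (simp add: infsum_cmult_right'[symmetric] mult_ac)
  qed
  finally show ?thesis .
qed

lemma conv_in_ell1:
  assumes "is_weight \<omega>" "f \<in> ell1 \<omega>" "g \<in> ell1 \<omega>"
  shows "conv f g \<in> ell1 \<omega>"
proof -
  have pos: "0 < \<omega> s" for s
    using is_weightD(2)[OF assms(1)] .
  have sm: "(\<lambda>(s, j). of_real (\<omega> s) * (f j * g (s - j))) abs_summable_on UNIV \<times> UNIV"
    using assms pos by (intro conv_double_abs_summable) (auto simp: less_imp_le)
  have row: "(\<lambda>j. of_real (\<omega> s) * (f j * g (s - j))) abs_summable_on UNIV" for s
    using sm unfolding Infinite_Sum.abs_summable_on_Sigma_iff by auto
  have rows: "(\<lambda>s. \<Sum>\<^sub>\<infinity>j. norm (of_real (\<omega> s) * (f j * g (s - j)))) abs_summable_on UNIV"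
    using sm unfolding Infinite_Sum.abs_summable_on_Sigma_iff by auto
  have "(\<lambda>s. norm (cmod (conv f g s) * \<omega> s)) summable_on UNIV"
  proof (rule Infinite_Sum.abs_summable_on_comparison_test'[OF abs_summable_summable[OF rows]])
    fix s
    have "norm (cmod (conv f g s) * \<omega> s) = norm (\<Sum>\<^sub>\<infinity>j. of_real (\<omega> s) * (f j * g (s - j)))"
      using pos[of s] by (simp add: conv_def infsum_cmult_right' norm_mult abs_mult)
    also have "\<dots> \<le> (\<Sum>\<^sub>\<infinity>j. norm (of_real (\<omega> s) * (f j * g (s - j))))"
      by (rule norm_infsum_bound[OF row])
    finally show "norm (cmod (conv f g s) * \<omega> s) \<le> \<dots>" .
  qed
  from abs_summable_summable[OF this] show ?thesis
    by (simp add: ell1_def)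
qed

lemma point_mass_in_ell1: "point_mass n \<in> ell1 \<omega>"
proof -
  have "(\<lambda>m. cmod (point_mass n m) * \<omega> m) summable_on {n}"
    by simp
  moreover have "(\<lambda>m. cmod (point_mass n m) * \<omega> m) summable_on UNIV
      \<longleftrightarrow> (\<lambda>m. cmod (point_mass n m) * \<omega> m) summable_on {n}"
    by (rule summable_on_cong_neutral) (auto simp: point_mass_def)
  ultimately show ?thesis by (simp add: ell1_def)
qed

lemma infsum_point_mass: "(\<Sum>\<^sub>\<infinity>m. point_mass n m * h m) = h n"
proof -
  have "(\<Sum>\<^sub>\<infinity>m. point_mass n m * h m) = (\<Sum>\<^sub>\<infinity>m\<in>{n}. point_mass n m * h m)"
    by (rule infsum_cong_neutral) (auto simp: point_mass_def)
  then show ?thesis by (simp add: point_mass_def)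
qed

lemma conv_point_mass_0: "conv (point_mass 0) f = f"
  by (simp add: conv_def infsum_point_mass)

lemma conv_zero_left: "conv (\<lambda>_. 0) f = (\<lambda>_. 0)"
  by (simp add: conv_def)

lemma generator_mem_generated_ideal:
  assumes "\<And>i. i \<in> {1..N} \<Longrightarrow> x i \<in> ell1 \<omega>" "k \<in> {1..N}"
  shows "x k \<in> {(\<lambda>m. \<Sum>i=1..N. conv (a i) (x i) m) | a. \<forall>i\<in>{1..N::nat}. a i \<in> ell1 \<omega>}"
proof -
  define a where "a i = (if i = k then point_mass 0 else (\<lambda>_. 0))" for i
  have "(\<Sum>i=1..N. conv (a i) (x i) m) = (\<Sum>i=1..N. if i = k then x k m else 0)" for m
    by (rule sum.cong) (auto simp: a_def conv_point_mass_0 conv_zero_left)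
  then have "x k = (\<lambda>m. \<Sum>i=1..N. conv (a i) (x i) m)"
    using assms(2) by simp
  moreover have "a i \<in> ell1 \<omega>" for i
    by (auto simp: a_def point_mass_in_ell1) (simp add: ell1_def)
  ultimately show ?thesis by blast
qed

text \<open>Restriction to \<open>ell1 \<omega>\<close> makes the functional extensional, as the elements of the character space
  are.\<close>

definition evaluation :: "(int \<Rightarrow> real) \<Rightarrow> complex \<Rightarrow> (int \<Rightarrow> complex) \<Rightarrow> complex" where
  "evaluation \<omega> z = restrict (\<lambda>f. \<Sum>\<^sub>\<infinity>n. z powi n * f n) (ell1 \<omega>)"

lemma evaluation_point_mass: "evaluation \<omega> z (point_mass n) = z powi n"
  by (simp add: evaluation_def point_mass_in_ell1 infsum_point_mass mult.commute[of "z powi _"])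

lemma ell1_add:
  assumes "f \<in> ell1 \<omega>" "g \<in> ell1 \<omega>" "is_weight \<omega>"
  shows "(\<lambda>n. f n + g n) \<in> ell1 \<omega>"
proof -
  have "(\<lambda>n. cmod (f n) * \<omega> n + cmod (g n) * \<omega> n) summable_on UNIV"
    using assms by (intro summable_on_add) (auto simp: ell1_def)
  then have "(\<lambda>n. cmod (f n + g n) * \<omega> n) summable_on UNIV"
  proof (rule summable_on_comparison_test)
    fix n
    have "cmod (f n + g n) * \<omega> n \<le> (cmod (f n) + cmod (g n)) * \<omega> n"
      using is_weightD(2)[OF assms(3), of n] by (intro mult_right_mono norm_triangle_ineq) auto
    then show "cmod (f n + g n) * \<omega> n \<le> cmod (f n) * \<omega> n + cmod (g n) * \<omega> n"
      by (simp add: distrib_right)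
    show "0 \<le> cmod (f n + g n) * \<omega> n"
      using is_weightD(2)[OF assms(3), of n] by simp
  qed
  then show ?thesis by (simp add: ell1_def)
qed

lemma ell1_cmult: "f \<in> ell1 \<omega> \<Longrightarrow> (\<lambda>n. c * f n) \<in> ell1 \<omega>"
  by (auto simp: ell1_def norm_mult mult.assoc intro: summable_on_cmult_right)

lemma evaluation_in_character_space:
  assumes w: "is_weight \<omega>" and z: "z \<noteq> 0" "\<And>n. cmod (z powi n) \<le> \<omega> n"
  shows "evaluation \<omega> z \<in> character_space \<omega>"
proof -
  have sm: "(\<lambda>n. z powi n * f n) summable_on UNIV" if "f \<in> ell1 \<omega>" for f
    by (rule abs_summable_summable, rule ell1_dominated_abs_summable[OF that z(2)])
  have "evaluation \<omega> z (conv f g) = evaluation \<omega> z f * evaluation \<omega> z g"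
    if "f \<in> ell1 \<omega>" "g \<in> ell1 \<omega>" for f g
  proof -
    have "(\<Sum>\<^sub>\<infinity>s. z powi s * conv f g s) = (\<Sum>\<^sub>\<infinity>j. f j * (\<Sum>\<^sub>\<infinity>p. z powi (j + p) * g p))"
      by (rule dominated_infsum_conv[OF w that z(2)])
    also have "\<dots> = (\<Sum>\<^sub>\<infinity>j. z powi j * f j * (\<Sum>\<^sub>\<infinity>p. z powi p * g p))"
      using z(1) by (simp add: power_int_add mult.assoc infsum_cmult_right' mult.left_commute[of "f _"])
    also have "\<dots> = (\<Sum>\<^sub>\<infinity>j. z powi j * f j) * (\<Sum>\<^sub>\<infinity>p. z powi p * g p)"
      by (simp add: infsum_cmult_left')
    finally show ?thesis
      using that conv_in_ell1[OF w that] by (simp add: evaluation_def)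
  qed
  moreover have "evaluation \<omega> z (\<lambda>n. f n + g n) = evaluation \<omega> z f + evaluation \<omega> z g"
    if "f \<in> ell1 \<omega>" "g \<in> ell1 \<omega>" for f g
    using that ell1_add[OF that w] infsum_add[OF sm sm, OF that]
    by (simp add: evaluation_def distrib_left)
  moreover have "evaluation \<omega> z (\<lambda>n. c * f n) = c * evaluation \<omega> z f" if "f \<in> ell1 \<omega>" for f c
    using that ell1_cmult[OF that, of c]
    by (simp add: evaluation_def infsum_cmult_right'[symmetric] mult.left_commute)
  moreover have "evaluation \<omega> z (point_mass 0) \<noteq> 0"
    by (simp add: evaluation_point_mass)
  moreover have "evaluation \<omega> z \<in> extensional (ell1 \<omega>)"
    by (simp add: evaluation_def)
  ultimately show ?thesis
    unfolding character_space_def using point_mass_in_ell1[of 0 \<omega>] by blast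
qed

lemma augmentation_ideal_eq_kernel:
  "augmentation_ideal \<omega> = {f \<in> ell1 \<omega>. evaluation \<omega> 1 f = 0}"
  by (auto simp: augmentation_ideal_def evaluation_def)

section \<open>Tail sums and a criterion against finite generation\<close>

text \<open>If \<open>f\<close> sums to zero, then \<open>tail_sum f\<close> is the formal quotient of \<open>f\<close> by
  \<open>point_mass 1 - point_mass 0\<close>.\<close>

definition tail_sum :: "(int \<Rightarrow> complex) \<Rightarrow> int \<Rightarrow> complex" where
  "tail_sum f m = (\<Sum>\<^sub>\<infinity>s. of_bool (m < s) * f s)"

text \<open>When the values of \<open>f\<close> sum to zero, the tail sum at \<open>q\<close> can be computed from either side of \<open>q\<close>.
  This is the side that does not contain \<open>0\<close>, so that it recedes to infinity with \<open>\<bar>q\<bar>\<close>; for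
  \<open>q \<ge> 0\<close> it excludes \<open>q\<close> and for \<open>q < 0\<close> it includes \<open>q\<close>, because the tail sum at \<open>q\<close> starts at
  \<open>q + 1\<close>.\<close>

definition away_from_zero :: "int \<Rightarrow> int set" where
  "away_from_zero q = (if 0 \<le> q then {s. q < s} else {s. s \<le> q})"

lemma ell1_of_bool_summable:
  assumes "is_weight \<omega>" "f \<in> ell1 \<omega>"
  shows "(\<lambda>s. of_bool (P s) * f s) abs_summable_on UNIV"
  using is_weightD(1)[OF assms(1)]
  by (intro ell1_dominated_abs_summable[OF assms(2)]) (auto simp: of_bool_def intro: order_trans[OF zero_le_one])

lemma tail_sum_conv:
  assumes "is_weight \<omega>" "f \<in> ell1 \<omega>" "g \<in> ell1 \<omega>"
  shows "tail_sum (conv f g) m = (\<Sum>\<^sub>\<infinity>j. f j * tail_sum g (m - j))"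
proof -
  have "cmod (of_bool (m < s)) \<le> \<omega> s" for s
    using is_weightD(1)[OF assms(1), of s] by (auto simp: of_bool_def)
  then have "tail_sum (conv f g) m = (\<Sum>\<^sub>\<infinity>j. f j * (\<Sum>\<^sub>\<infinity>p. of_bool (m < j + p) * g p))"
    unfolding tail_sum_def by (rule dominated_infsum_conv[OF assms])
  moreover have "m < j + p \<longleftrightarrow> m - j < p" for j p :: int
    by auto
  ultimately show ?thesis by (simp add: tail_sum_def)
qed

lemma norm_tail_sum_le:
  assumes "is_weight \<omega>" "f \<in> augmentation_ideal \<omega>"
  shows "cmod (tail_sum f q) \<le> (\<Sum>\<^sub>\<infinity>s\<in>away_from_zero q. cmod (f s))"
proof -
  have f: "f \<in> ell1 \<omega>" "(\<Sum>\<^sub>\<infinity>s. f s) = 0"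
    using assms(2) by (auto simp: augmentation_ideal_def)
  have abs: "f abs_summable_on A" for A
    using ell1_abs_summable[OF assms(1) f(1)] by (rule summable_on_subset_banach) simp
  have eq: "tail_sum f q = (\<Sum>\<^sub>\<infinity>s\<in>{s. q < s}. f s)"
    unfolding tail_sum_def by (rule infsum_cong_neutral) auto
  have "cmod (tail_sum f q) = cmod (\<Sum>\<^sub>\<infinity>s\<in>away_from_zero q. f s)"
  proof (cases "0 \<le> q")
    case True
    then show ?thesis using eq by (simp add: away_from_zero_def)
  next
    case False
    have "(\<Sum>\<^sub>\<infinity>s\<in>{s. q < s} \<union> {s. s \<le> q}. f s) = (\<Sum>\<^sub>\<infinity>s\<in>{s. q < s}. f s) + (\<Sum>\<^sub>\<infinity>s\<in>{s. s \<le> q}. f s)"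
      using abs_summable_summable[OF abs] by (intro infsum_Un_disjoint) auto
    moreover have "{s. q < s} \<union> {s. s \<le> q} = UNIV" by auto
    ultimately have "tail_sum f q = - (\<Sum>\<^sub>\<infinity>s\<in>{s. s \<le> q}. f s)"
      using eq f(2) by (simp add: add_eq_0_iff2)
    then show ?thesis using False by (simp add: away_from_zero_def)
  qed
  also have "\<dots> \<le> (\<Sum>\<^sub>\<infinity>s\<in>away_from_zero q. cmod (f s))"
    by (rule norm_infsum_bound[OF abs])
  finally show ?thesis .
qed

text \<open>The uniformity in \<open>q\<close> is the point. For \<open>\<bar>q\<bar>\<close> large the domination hypothesis
  transfers the factor \<open>\<omega> (p r)\<close> to the norm of \<open>f\<close> away from zero, which is at most \<open>\<epsilon>\<close>. For the
  remaining finitely many \<open>q\<close> the tail sums and \<open>\<omega> q\<close> are bounded, and \<open>\<omega> (m r) \<le> \<omega> q * \<omega> (m r - q)\<close>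
  leaves the ratio \<open>\<omega> (p r) / \<omega> (m r)\<close>, which tends to zero.\<close>

lemma tail_sum_small:
  fixes p m :: "nat \<Rightarrow> int"
  assumes w: "is_weight \<omega>" and f: "f \<in> augmentation_ideal \<omega>"
    and dominate: "\<And>r q s. s \<in> away_from_zero q \<Longrightarrow> \<omega> (p r) \<le> \<omega> s * \<omega> (m r - q)"
    and ratio: "(\<lambda>r. \<omega> (p r) / \<omega> (m r)) \<longlonglongrightarrow> 0"
    and "0 < \<epsilon>"
  shows "\<forall>\<^sub>F r in sequentially. \<forall>q. \<omega> (p r) * cmod (tail_sum f q) \<le> \<epsilon> * \<omega> (m r - q)"
proof -
  have pos: "0 < \<omega> s" "1 \<le> \<omega> s" for s
    using is_weightD[OF w] by auto
  have f1: "f \<in> ell1 \<omega>"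
    using f by (simp add: augmentation_ideal_def)
  have wsm: "(\<lambda>s. cmod (f s) * \<omega> s) summable_on A" for A
    by (rule summable_on_subset_banach[of _ UNIV]) (use f1 in \<open>auto simp: ell1_def\<close>)
  have asm: "(\<lambda>s. cmod (f s)) summable_on A" for A
    using ell1_abs_summable[OF w f1] by (rule summable_on_subset_banach) simp
  obtain F where F: "finite F" "dist (\<Sum>s\<in>F. cmod (f s) * \<omega> s) (\<Sum>\<^sub>\<infinity>s. cmod (f s) * \<omega> s) \<le> \<epsilon>"
    using infsum_finite_approximation[OF wsm \<open>0 < \<epsilon>\<close>] by blast
  \<comment> \<open>A symmetric interval containing \<open>F\<close>: outside it, the side of \<open>q\<close> away from zero misses \<open>F\<close>.\<close>
  define Q where "Q = {- Max (insert 0 (abs ` F)) .. Max (insert 0 (abs ` F))}"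
  define W where "W = Max (\<omega> ` Q)"
  define B where "B = (\<Sum>\<^sub>\<infinity>s. cmod (f s))"
  have B: "0 \<le> B" by (simp add: B_def infsum_nonneg)
  have far: "F \<inter> away_from_zero q = {}" if "q \<notin> Q" for q
  proof -
    have "\<bar>s\<bar> \<le> Max (insert 0 (abs ` F))" if "s \<in> F" for s
      using F(1) that by (intro Max_ge) auto
    then show ?thesis
      using \<open>q \<notin> Q\<close> by (force simp: Q_def away_from_zero_def split: if_splits)
  qed
  have "(\<lambda>r. B * W * (\<omega> (p r) / \<omega> (m r))) \<longlonglongrightarrow> B * W * 0"
    by (intro tendsto_intros ratio)
  then have "\<forall>\<^sub>F r in sequentially. B * W * (\<omega> (p r) / \<omega> (m r)) < \<epsilon>"
    using \<open>0 < \<epsilon>\<close> by (auto dest: order_tendstoD(2))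
  then show ?thesis
  proof eventually_elim
    case (elim r)
    show ?case
    proof
      fix q
      show "\<omega> (p r) * cmod (tail_sum f q) \<le> \<epsilon> * \<omega> (m r - q)"
      proof (cases "q \<in> Q")
        case True
        have "cmod (tail_sum f q) \<le> (\<Sum>\<^sub>\<infinity>s\<in>away_from_zero q. cmod (f s))"
          by (rule norm_tail_sum_le[OF w f])
        also have "\<dots> \<le> B"
          unfolding B_def by (rule infsum_mono_neutral[OF asm asm]) auto
        finally have 1: "cmod (tail_sum f q) \<le> B" .
        have "\<omega> q \<le> W"
          unfolding W_def Q_def using True by (intro Max_ge) (auto simp: Q_def)
        then have "\<omega> q * \<omega> (m r - q) \<le> W * \<omega> (m r - q)"
          using pos(1)[of "m r - q"] by (intro mult_right_mono) auto
        then have 2: "\<omega> (m r) \<le> W * \<omega> (m r - q)"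
          using is_weightD(3)[OF w, of q "m r - q"] by simp
        have "\<omega> (p r) * cmod (tail_sum f q) \<le> \<omega> (p r) * B"
          using 1 pos(1)[of "p r"] by simp
        also have "\<dots> = B * (\<omega> (p r) / \<omega> (m r)) * \<omega> (m r)"
          using pos(1)[of "m r"] by simp
        also have "\<dots> \<le> B * (\<omega> (p r) / \<omega> (m r)) * (W * \<omega> (m r - q))"
          using 2 B pos(1)[of "p r"] pos(1)[of "m r"] by (intro mult_left_mono) auto
        also have "\<dots> = (B * W * (\<omega> (p r) / \<omega> (m r))) * \<omega> (m r - q)"
          by simp
        also have "\<dots> \<le> \<epsilon> * \<omega> (m r - q)"
          using elim pos(1)[of "m r - q"] by (intro mult_right_mono) auto
        finally show ?thesis .
      next
        case False
        have "(\<Sum>s\<in>F. cmod (f s) * \<omega> s) + (\<Sum>\<^sub>\<infinity>s\<in>away_from_zero q. cmod (f s) * \<omega> s)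
            = (\<Sum>\<^sub>\<infinity>s\<in>F \<union> away_from_zero q. cmod (f s) * \<omega> s)"
          using F(1) far[OF False] by (subst infsum_Un_disjoint[OF wsm wsm]) auto
        also have "\<dots> \<le> (\<Sum>\<^sub>\<infinity>s. cmod (f s) * \<omega> s)"
          using pos(1) by (intro infsum_mono_neutral[OF wsm wsm]) (auto simp: less_imp_le)
        finally have rest: "(\<Sum>\<^sub>\<infinity>s\<in>away_from_zero q. cmod (f s) * \<omega> s) \<le> \<epsilon>"
          using F(2) by (simp add: dist_real_def)
        have "\<omega> (p r) * cmod (tail_sum f q)
            \<le> \<omega> (p r) * (\<Sum>\<^sub>\<infinity>s\<in>away_from_zero q. cmod (f s))"
          using norm_tail_sum_le[OF w f, of q] pos(1)[of "p r"] by simp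
        also have "\<dots> = (\<Sum>\<^sub>\<infinity>s\<in>away_from_zero q. \<omega> (p r) * cmod (f s))"
          by (simp add: infsum_cmult_right')
        also have "\<dots> \<le> (\<Sum>\<^sub>\<infinity>s\<in>away_from_zero q. cmod (f s) * \<omega> s * \<omega> (m r - q))"
        proof (rule infsum_mono)
          show "\<omega> (p r) * cmod (f s) \<le> cmod (f s) * \<omega> s * \<omega> (m r - q)"
            if "s \<in> away_from_zero q" for s
            using mult_left_mono[OF dominate[OF that, of r] norm_ge_zero[of "f s"]]
            by (simp add: mult_ac)
        qed (intro summable_on_cmult_right summable_on_cmult_left asm wsm)+
        also have "\<dots> \<le> \<epsilon> * \<omega> (m r - q)"
          using rest pos(1)[of "m r - q"] by (simp add: infsum_cmult_left')
        finally show ?thesis .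
      qed
    qed
  qed
qed

text \<open>The element is \<open>\<Sum>l. 2 ^ (- l) / \<omega> (P l) * (\<delta>\<^bsub>P l\<^esub> - \<delta>\<^sub>0)\<close>. Since \<open>M l \<ge> 0\<close>, its only negative
  coefficient, the one at \<open>0\<close>, does not contribute to the tail sum at \<open>M l\<close>, which is therefore at
  least the coefficient at \<open>P l\<close>.\<close>

lemma exists_element_with_large_tails:
  fixes P M :: "nat \<Rightarrow> int"
  assumes w: "is_weight \<omega>" and P: "inj P" and M: "\<And>l. 0 \<le> M l" "\<And>l. M l < P l"
  obtains f where "f \<in> augmentation_ideal \<omega>"
    "\<And>l. (1 / 2) ^ l \<le> \<omega> (P l) * cmod (tail_sum f (M l))"
proof -
  define a where "a s = (if s \<in> range P then (1 / 2) ^ (inv P s) / \<omega> s else (0::real))" for s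
  have pos: "0 < \<omega> s" "1 \<le> \<omega> s" for s
    using is_weightD[OF w] by auto
  have a0: "0 \<le> a s" for s
    using pos(1)[of s] by (simp add: a_def)
  have aP: "a (P l) = (1 / 2) ^ l / \<omega> (P l)" for l
    using P by (simp add: a_def)
  have "(\<lambda>l. (1 / 2 :: real) ^ l) summable_on UNIV"
    by (subst summable_on_UNIV_nonneg_real_iff) auto
  moreover have "(\<lambda>s. a s * \<omega> s) \<circ> P = (\<lambda>l. (1 / 2) ^ l)"
    using pos(1) by (auto simp: aP less_imp_neq[THEN not_sym])
  ultimately have "(\<lambda>s. a s * \<omega> s) summable_on range P"
    using P by (simp add: summable_on_reindex)
  then have awsm: "(\<lambda>s. a s * \<omega> s) summable_on UNIV"
    by (subst summable_on_cong_neutral[where T = "range P"]) (auto simp: a_def)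
  then have asm: "a summable_on UNIV"
    by (rule summable_on_comparison_test)
       (use a0 mult_left_mono[OF pos(2) a0] in \<open>simp_all add: mult.commute\<close>)
  define g where "g = (\<lambda>s. complex_of_real (a s))"
  define C where "C = infsum a UNIV"
  define f where "f = (\<lambda>s. g s + - of_real C * point_mass 0 s)"
  have g1: "g \<in> ell1 \<omega>"
    using awsm a0 by (simp add: ell1_def g_def)
  have f1: "f \<in> ell1 \<omega>"
    unfolding f_def by (intro ell1_add ell1_cmult point_mass_in_ell1 g1 w)
  have "(g has_sum of_real C) UNIV"
    unfolding g_def C_def by (intro has_sum_of_real has_sum_infsum asm)
  moreover have "((\<lambda>s. - of_real C * point_mass 0 s) has_sum (- of_real C)) UNIV"
    by (rule has_sum_finite_neutralI[of "{0}"]) (auto simp: point_mass_def)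
  ultimately have "(f has_sum (of_real C + - of_real C)) UNIV"
    unfolding f_def by (rule has_sum_add)
  then have "infsum f UNIV = 0"
    by (simp add: infsumI)
  then have fI: "f \<in> augmentation_ideal \<omega>"
    using f1 by (simp add: augmentation_ideal_def)
  moreover have "(1 / 2) ^ l \<le> \<omega> (P l) * cmod (tail_sum f (M l))" for l
  proof -
    let ?b = "\<lambda>s. of_bool (M l < s) * a s"
    have "of_bool (M l < s) * f s = of_real (?b s)" for s
      using M(1)[of l] by (auto simp: f_def g_def point_mass_def)
    moreover have bsm: "?b summable_on UNIV"
      using a0 by (intro summable_on_comparison_test[OF asm]) auto
    ultimately have "tail_sum f (M l) = of_real (infsum ?b UNIV)"
      unfolding tail_sum_def
      using has_sum_of_real[OF has_sum_infsum[OF bsm], where 'a = complex]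
      by (simp add: infsumI del: of_real_mult)
    moreover have "a (P l) \<le> infsum ?b UNIV"
    proof -
      have "sum ?b {P l} \<le> infsum ?b UNIV"
        by (rule finite_sum_le_infsum[OF bsm]) (use a0 in auto)
      then show ?thesis using M(2)[of l] by simp
    qed
    ultimately have "a (P l) \<le> cmod (tail_sum f (M l))"
      using a0[of "P l"] by simp
    then show ?thesis
      using pos(1)[of "P l"] by (simp add: aP divide_le_eq mult.commute)
  qed
  ultimately show ?thesis using that by blast
qed

lemma has_sum_sum:
  fixes f :: "'a \<Rightarrow> 'b \<Rightarrow> 'c::topological_comm_monoid_add"
  assumes "\<And>i. i \<in> S \<Longrightarrow> (f i has_sum c i) A"
  shows "((\<lambda>s. \<Sum>i\<in>S. f i s) has_sum (\<Sum>i\<in>S. c i)) A"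
  using assms by (induction S rule: infinite_finite_induct) (auto intro: has_sum_add)

text \<open>Abstract criterion: the weight at \<open>m r\<close> exceeds the weight at the larger point \<open>p r\<close> by an unbounded
  factor, while any way of reaching beyond \<open>m r\<close> costs at least \<open>\<omega> (p r)\<close>. Along a subsequence \<open>R\<close>
  the tails of all elements of the ideal generated by \<open>x 1, \<dots>, x N\<close> are \<open>O((1 / 4) ^ l)\<close> after
  multiplication by \<open>\<omega> (p (R l))\<close>, while some element of the augmentation ideal has tails of size
  \<open>(1 / 2) ^ l\<close>.\<close>

theorem augmentation_ideal_not_finitely_generated:
  fixes p m :: "nat \<Rightarrow> int"
  assumes w: "is_weight \<omega>"
    and p: "inj p" and m: "\<And>r. 0 \<le> m r" "\<And>r. m r < p r"
    and dominate: "\<And>r q s. s \<in> away_from_zero q \<Longrightarrow> \<omega> (p r) \<le> \<omega> s * \<omega> (m r - q)"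
    and ratio: "(\<lambda>r. \<omega> (p r) / \<omega> (m r)) \<longlonglongrightarrow> 0"
  shows "\<not> finitely_generated_ideal \<omega> (augmentation_ideal \<omega>)"
proof
  assume "finitely_generated_ideal \<omega> (augmentation_ideal \<omega>)"
  then obtain N :: nat and x where x1: "\<And>i. i \<in> {1..N} \<Longrightarrow> x i \<in> ell1 \<omega>"
    and I: "augmentation_ideal \<omega>
      = {(\<lambda>m. \<Sum>i=1..N. conv (a i) (x i) m) | a. \<forall>i\<in>{1..N}. a i \<in> ell1 \<omega>}"
    unfolding finitely_generated_ideal_def by blast
  have xI: "x i \<in> augmentation_ideal \<omega>" if "i \<in> {1..N}" for i
    unfolding I using x1 that by (rule generator_mem_generated_ideal)
  have pos: "0 < \<omega> s" for s
    using is_weightD[OF w] by auto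
  define good where "good l r \<longleftrightarrow> (\<forall>i\<in>{1..N}. \<forall>q.
      \<omega> (p r) * cmod (tail_sum (x i) q) \<le> (1 / 4) ^ l * \<omega> (m r - q))" for l r :: nat
  have "\<forall>\<^sub>F r in sequentially. good l r" for l
    unfolding good_def
    by (intro eventually_ball_finite ballI tail_sum_small[OF w xI dominate ratio]) auto
  then have ex: "\<exists>r>r0. good l r" for l r0
    using eventually_happens[OF eventually_conj[OF _ eventually_gt_at_top[of r0]]] by force
  have "\<exists>R :: nat \<Rightarrow> nat. \<forall>l. good l (R l) \<and> R l < R (Suc l)"
    by (rule dependent_nat_choice) (use ex in auto)
  then obtain R where R: "\<And>l. good l (R l)" "strict_mono R"
    by (auto simp: strict_mono_Suc_iff)
  have "inj (\<lambda>l. p (R l))"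
    using inj_compose[OF p strict_mono_imp_inj_on[OF R(2)]] by (simp add: o_def)
  then obtain f where f: "f \<in> augmentation_ideal \<omega>"
    "\<And>l. (1 / 2) ^ l \<le> \<omega> (p (R l)) * cmod (tail_sum f (m (R l)))"
    using exists_element_with_large_tails[where M = "\<lambda>l. m (R l)", OF w _ m(1) m(2)] by blast
  then obtain a where a: "\<And>i. i \<in> {1..N} \<Longrightarrow> a i \<in> ell1 \<omega>"
    and fa: "f = (\<lambda>m. \<Sum>i=1..N. conv (a i) (x i) m)"
    unfolding I by blast
  \<comment> \<open>The norm of the coefficient tuple, which does not depend on \<open>l\<close>.\<close>
  define A where "A = (\<Sum>i=1..N. \<Sum>\<^sub>\<infinity>j. cmod (a i j) * \<omega> j)"
  have "(1 / 2) ^ l \<le> (1 / 4) ^ l * A" for l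
  proof -
    let ?w = "\<omega> (p (R l))" and ?m = "m (R l)"
    have "tail_sum f ?m = (\<Sum>\<^sub>\<infinity>s. \<Sum>i=1..N. of_bool (?m < s) * conv (a i) (x i) s)"
      by (simp add: tail_sum_def fa sum_distrib_left)
    also have "\<dots> = (\<Sum>i=1..N. tail_sum (conv (a i) (x i)) ?m)"
      unfolding tail_sum_def
      by (intro infsumI has_sum_sum has_sum_infsum abs_summable_summable[OF ell1_of_bool_summable[OF w]]
          conv_in_ell1[OF w] a x1)
    also have "\<dots> = (\<Sum>i=1..N. \<Sum>\<^sub>\<infinity>j. a i j * tail_sum (x i) (?m - j))"
      by (intro sum.cong refl tail_sum_conv[OF w] a x1)
    finally have "?w * cmod (tail_sum f ?m)
        \<le> (\<Sum>i=1..N. ?w * cmod (\<Sum>\<^sub>\<infinity>j. a i j * tail_sum (x i) (?m - j)))"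
      using pos[of "p (R l)"] norm_sum by (simp add: sum_distrib_left[symmetric])
    also have "\<dots> \<le> (\<Sum>i=1..N. (1 / 4) ^ l * (\<Sum>\<^sub>\<infinity>j. cmod (a i j) * \<omega> j))"
    proof (rule sum_mono)
      fix i
      assume i: "i \<in> {1..N}"
      have sm: "(\<lambda>j. (1 / 4) ^ l * (cmod (a i j) * \<omega> j)) summable_on UNIV"
        using a[OF i] by (intro summable_on_cmult_right) (auto simp: ell1_def)
      have le: "norm (of_real ?w * (a i j * tail_sum (x i) (?m - j)))
          \<le> (1 / 4) ^ l * (cmod (a i j) * \<omega> j)" for j
      proof -
        have "?w * cmod (tail_sum (x i) (?m - j)) \<le> (1 / 4) ^ l * \<omega> j"
          using bspec[OF R(1)[of l, unfolded good_def] i, THEN spec, of "?m - j"] by simp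
        from mult_left_mono[OF this norm_ge_zero[of "a i j"]] show ?thesis
          using pos[of "p (R l)"] by (simp add: norm_mult mult_ac)
      qed
      have abs: "(\<lambda>j. of_real ?w * (a i j * tail_sum (x i) (?m - j))) abs_summable_on UNIV"
        by (rule Infinite_Sum.abs_summable_on_comparison_test'[OF sm le])
      have "?w * cmod (\<Sum>\<^sub>\<infinity>j. a i j * tail_sum (x i) (?m - j))
          = cmod (\<Sum>\<^sub>\<infinity>j. of_real ?w * (a i j * tail_sum (x i) (?m - j)))"
        using pos[of "p (R l)"] by (simp add: infsum_cmult_right' norm_mult)
      also have "\<dots> \<le> (\<Sum>\<^sub>\<infinity>j. norm (of_real ?w * (a i j * tail_sum (x i) (?m - j))))"
        by (rule norm_infsum_bound[OF abs])
      also have "\<dots> \<le> (\<Sum>\<^sub>\<infinity>j. (1 / 4) ^ l * (cmod (a i j) * \<omega> j))"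
        by (rule infsum_mono[OF abs sm le])
      also have "\<dots> = (1 / 4) ^ l * (\<Sum>\<^sub>\<infinity>j. cmod (a i j) * \<omega> j)"
        by (rule infsum_cmult_right')
      finally show "?w * cmod (\<Sum>\<^sub>\<infinity>j. a i j * tail_sum (x i) (?m - j)) \<le> \<dots>" .
    qed
    also have "\<dots> = (1 / 4) ^ l * A"
      by (simp add: A_def sum_distrib_left)
    finally show ?thesis using f(2)[of l] by linarith
  qed
  then have "2 ^ l \<le> A" for l
  proof -
    have "(1 / 4 :: real) ^ l = (1 / 2) ^ l * (1 / 2) ^ l"
      by (simp add: power_mult_distrib[symmetric])
    with \<open>(1 / 2) ^ l \<le> (1 / 4) ^ l * A\<close> have "1 \<le> (1 / 2) ^ l * A"
      by simp
    then show ?thesis by (simp add: power_one_over divide_simps)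
  qed
  moreover obtain l where "A < 2 ^ l"
    using real_arch_pow[of 2 A] by auto
  ultimately show False by (meson not_less)
qed

section \<open>The weight built from the greedy length\<close>

text \<open>The exponent of \<open>\<rho> + 1\<close> in the weight: the summand \<open>nat (- m)\<close> accounts for the factor
  \<open>(\<rho> + 1) ^ n\<close> in the extension of \<open>\<gamma>\<close> to negative arguments.\<close>

definition signed_length :: "int \<Rightarrow> nat" where
  "signed_length m = mersenne_length (nat \<bar>m\<bar>) + nat (- m)"

lemma signed_length_nonneg [simp]: "signed_length (int j) = mersenne_length j"
  by (simp add: signed_length_def)

lemma signed_length_nonpos [simp]: "signed_length (- int j) = mersenne_length j + j"
  by (simp add: signed_length_def)

text \<open>Subtracting \<open>j\<close> from \<open>i\<close> may increase the length by \<open>j\<close>, and exactly this is compensated by the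
  additional \<open>j\<close> in the length of \<open>- j\<close>.\<close>

lemma signed_length_diff:
  "signed_length (int i - int j) \<le> signed_length (int i) + signed_length (- int j)"
proof (cases "j \<le> i")
  case True
  then have "int i - int j = int (i - j)" by simp
  then show ?thesis using mersenne_length_diff[of i j] by (simp del: of_nat_diff)
next
  case False
  then have "int i - int j = - int (j - i)" by simp
  then show ?thesis using mersenne_length_diff[of j i] False by (simp del: of_nat_diff)
qed

lemma signed_length_subadditive: "signed_length (m + n) \<le> signed_length m + signed_length n"
proof (cases m rule: int_cases2; cases n rule: int_cases2)
  fix i j
  assume "m = int i" "n = int j"
  then show ?thesis
    using mersenne_length_subadditive[of i j] by (simp flip: of_nat_add)
next
  fix i j
  assume "m = int i" "n = - int j"
  then show ?thesis using signed_length_diff[of i j] by simp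
next
  fix i j
  assume "m = - int i" "n = int j"
  then show ?thesis using signed_length_diff[of j i] by simp
next
  fix i j
  assume mn: "m = - int i" "n = - int j"
  have "m + n = - int (i + j)" using mn by simp
  then have "signed_length (m + n) = mersenne_length (i + j) + (i + j)"
    by (simp only: signed_length_nonpos)
  then show ?thesis
    using mersenne_length_subadditive[of i j] mn by simp
qed

definition mersenne_weight :: "real \<Rightarrow> int \<Rightarrow> real" where
  "mersenne_weight \<rho> m = \<rho> ^ nat \<bar>m\<bar> * (\<rho> + 1) ^ signed_length m"

lemma mersenne_weight_nonneg_arg: "mersenne_weight \<rho> (int j) = \<rho> ^ j * (\<rho> + 1) ^ mersenne_length j"
  by (simp add: mersenne_weight_def)

lemma mersenne_weight_nonpos_arg:
  "mersenne_weight \<rho> (- int j) = \<rho> ^ j * (\<rho> + 1) ^ (mersenne_length j + j)"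
  by (simp add: mersenne_weight_def)

context
  fixes \<rho> :: real
  assumes rho: "1 < \<rho>"
begin

lemma is_weight_mersenne_weight: "is_weight (mersenne_weight \<rho>)"
  unfolding is_weight_def
proof (intro conjI allI)
  show "1 \<le> mersenne_weight \<rho> n" for n
    unfolding mersenne_weight_def using rho
    by (intro mult_ge1_I one_le_power) auto
  show "mersenne_weight \<rho> (m + n) \<le> mersenne_weight \<rho> m * mersenne_weight \<rho> n" for m n
  proof -
    have "mersenne_weight \<rho> (m + n)
        \<le> \<rho> ^ (nat \<bar>m\<bar> + nat \<bar>n\<bar>) * (\<rho> + 1) ^ (signed_length m + signed_length n)"
      unfolding mersenne_weight_def using rho signed_length_subadditive[of m n]
      by (intro mult_mono power_increasing) auto
    then show ?thesis by (simp add: mersenne_weight_def power_add mult_ac)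
  qed
  show "mersenne_weight \<rho> 0 = 1"
    by (simp add: mersenne_weight_def signed_length_def)
qed

lemma mersenne_weight_mersenne:
  "1 \<le> k \<Longrightarrow> mersenne_weight \<rho> (int (2 ^ k - 1)) = \<rho> ^ (2 ^ k - 1) * (\<rho> + 1)"
  using mersenne_length_mersenne[of k] by (simp only: mersenne_weight_nonneg_arg power_one_right)

lemma mersenne_weight_before_mersenne:
  "u < k \<Longrightarrow> mersenne_weight \<rho> (int (2 ^ k - 1 - u)) = \<rho> ^ (2 ^ k - 1 - u) * (\<rho> + 1) ^ Suc u"
  using mersenne_length_before_mersenne[of u k] by (simp only: mersenne_weight_nonneg_arg)

lemma le_mersenne_of_less: "u < k \<Longrightarrow> u \<le> 2 ^ k - 1" for u k :: nat
  using less_exp[of k] by linarith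

lemma mersenne_weight_ge:
  assumes "1 \<le> j"
  shows "\<rho> ^ j * (\<rho> + 1) \<le> mersenne_weight \<rho> (int j)"
proof -
  have "(\<rho> + 1) ^ 1 \<le> (\<rho> + 1) ^ mersenne_length j"
    using rho mersenne_length_pos[of j] assms by (intro power_increasing) auto
  then show ?thesis
    using rho by (simp add: mersenne_weight_nonneg_arg)
qed

text \<open>To the right of a Mersenne number the power of \<open>\<rho>\<close> grows; up to \<open>k - 1\<close> places to the left, each
  lost factor \<open>\<rho>\<close> is replaced by a factor \<open>\<rho> + 1\<close>.\<close>

lemma mersenne_weight_mersenne_le:
  assumes "1 \<le> k" "- int k < t"
  shows "mersenne_weight \<rho> (int (2 ^ k - 1)) \<le> mersenne_weight \<rho> (int (2 ^ k - 1) + t)"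
proof (cases "0 \<le> t")
  case True
  define j where "j = (2 ^ k - 1) + nat t"
  have j: "int (2 ^ k - 1) + t = int j" using True unfolding j_def by linarith
  have n: "1 \<le> (2::nat) ^ k - 1" using le_mersenne_of_less[of 0 k] less_exp[of k] assms(1) by linarith
  have "\<rho> ^ (2 ^ k - 1) * (\<rho> + 1) \<le> \<rho> ^ j * (\<rho> + 1)"
    using rho by (intro mult_right_mono power_increasing) (auto simp: j_def)
  also have "\<dots> \<le> mersenne_weight \<rho> (int j)"
    using n by (intro mersenne_weight_ge) (simp add: j_def)
  finally show ?thesis
    unfolding j mersenne_weight_mersenne[OF assms(1)] .
next
  case False
  define u where "u = nat (- t)"
  have u: "u < k" using assms False by (simp add: u_def)
  have le: "u \<le> 2 ^ k - 1" using le_mersenne_of_less[OF u] .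
  have m: "int (2 ^ k - 1) + t = int (2 ^ k - 1 - u)"
    using le False unfolding u_def by linarith
  have "\<rho> ^ (2 ^ k - 1) = \<rho> ^ (2 ^ k - 1 - u) * \<rho> ^ u"
    using le by (simp only: power_add[symmetric] le_add_diff_inverse2)
  also have "\<dots> \<le> \<rho> ^ (2 ^ k - 1 - u) * (\<rho> + 1) ^ u"
    using rho by (intro mult_left_mono power_mono) auto
  finally have "\<rho> ^ (2 ^ k - 1) * (\<rho> + 1) \<le> \<rho> ^ (2 ^ k - 1 - u) * (\<rho> + 1) ^ u * (\<rho> + 1)"
    using rho by (intro mult_right_mono) auto
  then show ?thesis
    unfolding m mersenne_weight_mersenne[OF assms(1)] mersenne_weight_before_mersenne[OF u]
    by (simp only: power_Suc2 mult.assoc)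
qed

text \<open>By submultiplicativity the right-hand side is at least the weight at
  \<open>2 ^ (2 * r) - 1 - r + (s - q)\<close>, and if \<open>s - q > - r\<close> this point is less than \<open>2 * r\<close> places to the
  left of the Mersenne number, so \<open>mersenne_weight_mersenne_le\<close> applies; this is why the exponent of
  the Mersenne number is twice the displacement. Otherwise \<open>s\<close> is negative with \<open>\<bar>s\<bar> \<ge> r\<close>, and the
  powers of \<open>\<rho>\<close> alone suffice.\<close>

lemma mersenne_weight_dominate:
  assumes "1 \<le> r" "s \<in> away_from_zero q"
  shows "mersenne_weight \<rho> (int (2 ^ (2 * r) - 1))
    \<le> mersenne_weight \<rho> s * mersenne_weight \<rho> (int (2 ^ (2 * r) - 1 - r) - q)"
proof -
  define n :: nat where "n = 2 ^ (2 * r) - 1"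
  have r: "r \<le> n" using le_mersenne_of_less[of r "2 * r"] assms(1) unfolding n_def by linarith
  show ?thesis
  proof (cases "- int r < s - q")
    case True
    have "mersenne_weight \<rho> (int n) \<le> mersenne_weight \<rho> (int n + (s - q - int r))"
      unfolding n_def using assms True by (intro mersenne_weight_mersenne_le) auto
    also have "int n + (s - q - int r) = s + (int (n - r) - q)"
      using r by simp
    also have "mersenne_weight \<rho> \<dots> \<le> mersenne_weight \<rho> s * mersenne_weight \<rho> (int (n - r) - q)"
      by (rule is_weightD(3)[OF is_weight_mersenne_weight])
    finally show ?thesis unfolding n_def .
  next
    case False
    then have s: "s \<le> q" "q < 0" "s - q \<le> - int r"
      using assms by (auto simp: away_from_zero_def split: if_splits)
    define j where "j = n - r + nat (- q)"
    have j: "int (n - r) - q = int j" "1 \<le> j" using s unfolding j_def by linarith+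
    have "\<rho> ^ n * (\<rho> + 1) \<le> \<rho> ^ (nat \<bar>s\<bar> + j) * (\<rho> + 1)"
      using rho s r by (intro mult_right_mono power_increasing) (auto simp: j_def)
    also have "\<dots> = \<rho> ^ nat \<bar>s\<bar> * (\<rho> ^ j * (\<rho> + 1))"
      by (simp add: power_add)
    also have "\<dots> \<le> mersenne_weight \<rho> s * mersenne_weight \<rho> (int j)"
    proof (rule mult_mono[OF _ mersenne_weight_ge[OF j(2)]])
      show "\<rho> ^ nat \<bar>s\<bar> \<le> mersenne_weight \<rho> s"
        unfolding mersenne_weight_def using rho by (simp add: mult_le_cancel_left1 one_le_power)
    qed (use rho is_weightD(2)[OF is_weight_mersenne_weight, of s] in auto)
    finally show ?thesis
      using mersenne_weight_mersenne[of "2 * r"] assms(1) j(1) unfolding n_def by simp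
  qed
qed

lemma mersenne_weight_ratio:
  "(\<lambda>r. mersenne_weight \<rho> (int (2 ^ (2 * Suc r) - 1))
      / mersenne_weight \<rho> (int (2 ^ (2 * Suc r) - 1 - Suc r))) \<longlonglongrightarrow> 0"
proof -
  have "mersenne_weight \<rho> (int (2 ^ (2 * Suc r) - 1))
      / mersenne_weight \<rho> (int (2 ^ (2 * Suc r) - 1 - Suc r)) = (\<rho> / (\<rho> + 1)) ^ Suc r" for r
  proof -
    define n :: nat where "n = 2 ^ (2 * Suc r) - 1"
    have "Suc r \<le> n" unfolding n_def by (rule le_mersenne_of_less) simp
    then have "\<rho> ^ n = \<rho> ^ (n - Suc r) * \<rho> ^ Suc r"
      by (simp only: power_add[symmetric] le_add_diff_inverse2)
    moreover have "mersenne_weight \<rho> (int n) = \<rho> ^ n * (\<rho> + 1)"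
      unfolding n_def by (rule mersenne_weight_mersenne) simp
    moreover have "mersenne_weight \<rho> (int (n - Suc r)) = \<rho> ^ (n - Suc r) * (\<rho> + 1) ^ Suc (Suc r)"
      unfolding n_def by (rule mersenne_weight_before_mersenne) simp
    ultimately show ?thesis
      unfolding n_def[symmetric] using rho by (simp add: power_divide)
  qed
  moreover have "(\<lambda>r. (\<rho> / (\<rho> + 1)) ^ Suc r) \<longlonglongrightarrow> 0"
    using rho by (intro LIMSEQ_Suc LIMSEQ_realpow_zero) auto
  ultimately show ?thesis by simp
qed

text \<open>The index is shifted by one because the displacement \<open>r\<close> must be positive.\<close>

lemma mersenne_weight_not_finitely_generated:
  "\<not> finitely_generated_ideal (mersenne_weight \<rho>) (augmentation_ideal (mersenne_weight \<rho>))"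
proof (rule augmentation_ideal_not_finitely_generated[OF is_weight_mersenne_weight _ _ _ _ mersenne_weight_ratio])
  show "inj (\<lambda>r. int (2 ^ (2 * Suc r) - 1))"
  proof (rule injI)
    fix r r' :: nat
    assume "int (2 ^ (2 * Suc r) - 1) = int (2 ^ (2 * Suc r') - 1)"
    then have "(2::nat) ^ (2 * Suc r) = 2 ^ (2 * Suc r')"
      using one_le_power[of "2::nat" "2 * Suc r"] one_le_power[of "2::nat" "2 * Suc r'"] by linarith
    then show "r = r'" by (simp add: power_inject_exp del: power_Suc)
  qed
  show "int (2 ^ (2 * Suc r) - 1 - Suc r) < int (2 ^ (2 * Suc r) - 1)" for r
  proof -
    have "Suc r \<le> 2 ^ (2 * Suc r) - 1" by (rule le_mersenne_of_less) simp
    then show ?thesis by linarith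
  qed
  show "mersenne_weight \<rho> (int (2 ^ (2 * Suc r) - 1))
      \<le> mersenne_weight \<rho> s * mersenne_weight \<rho> (int (2 ^ (2 * Suc r) - 1 - Suc r) - q)"
    if "s \<in> away_from_zero q" for r q s
    by (rule mersenne_weight_dominate[OF _ that]) simp
qed simp

section \<open>Characters and radii\<close>

lemma power_int_le_mersenne_weight:
  assumes "1 / (\<rho> * (\<rho> + 1)) \<le> cmod z" "cmod z \<le> \<rho>"
  shows "cmod (z powi n) \<le> mersenne_weight \<rho> n"
proof (cases n rule: int_cases2)
  case (nonneg j)
  have "cmod z ^ j \<le> \<rho> ^ j"
    using assms by (intro power_mono) auto
  also have "\<dots> \<le> \<rho> ^ j * (\<rho> + 1) ^ mersenne_length j"
    using rho by (simp add: mult_le_cancel_left1 one_le_power)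
  finally show ?thesis
    using nonneg by (simp add: mersenne_weight_nonneg_arg norm_power)
next
  case (nonpos j)
  have z: "0 < cmod z"
    using assms(1) rho by (smt (verit) divide_pos_pos mult_pos_pos)
  have "1 \<le> cmod z * (\<rho> * (\<rho> + 1))"
    using rho assms(1) pos_divide_le_eq[of "\<rho> * (\<rho> + 1)" 1 "cmod z"] by simp
  then have "1 / cmod z \<le> \<rho> * (\<rho> + 1)"
    using z by (simp add: divide_le_eq mult.commute)
  then have "(1 / cmod z) ^ j \<le> (\<rho> * (\<rho> + 1)) ^ j"
    using z by (intro power_mono) auto
  also have "\<dots> \<le> (\<rho> * (\<rho> + 1)) ^ j * (\<rho> + 1) ^ mersenne_length j"
    using rho mult_left_mono[of 1 "(\<rho> + 1) ^ mersenne_length j" "(\<rho> * (\<rho> + 1)) ^ j"]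
    by (simp add: one_le_power)
  finally show ?thesis
    using nonpos
    by (simp add: mersenne_weight_nonpos_arg norm_power norm_inverse power_int_minus
        power_mult_distrib power_add inverse_eq_divide power_divide norm_divide mult_ac)
qed

lemma evaluation_in_mersenne_character_space:
  assumes "1 / (\<rho> * (\<rho> + 1)) \<le> cmod z" "cmod z \<le> \<rho>"
  shows "evaluation (mersenne_weight \<rho>) z \<in> character_space (mersenne_weight \<rho>)"
proof (rule evaluation_in_character_space[OF is_weight_mersenne_weight])
  show "z \<noteq> 0"
    using assms(1) rho by (auto simp: divide_le_0_iff mult_le_0_iff)
qed (rule power_int_le_mersenne_weight[OF assms])

lemma one_in_interior_annulus:
  assumes "annulus (1 / (\<rho> * (\<rho> + 1))) \<rho> \<subseteq> S"
  shows "1 \<in> interior S"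
proof (rule interiorI)
  show "open {z :: complex. 1 / (\<rho> * (\<rho> + 1)) < cmod z \<and> cmod z < \<rho>}"
    by (intro open_Collect_conj open_Collect_less continuous_intros)
  have "1 * 1 < \<rho> * (\<rho> + 1)"
    using rho by (intro mult_strict_mono) auto
  then show "1 \<in> {z :: complex. 1 / (\<rho> * (\<rho> + 1)) < cmod z \<and> cmod z < \<rho>}"
    using rho by (simp add: divide_less_eq)
  show "{z :: complex. 1 / (\<rho> * (\<rho> + 1)) < cmod z \<and> cmod z < \<rho>} \<subseteq> S"
    using assms by (auto simp: annulus_def)
qed

lemma mersenne_length_sublinear: "(\<lambda>j. mersenne_length j / real j) \<longlonglongrightarrow> 0"
proof (rule tendsto_sandwich[of "\<lambda>_. 0"])
  show "\<forall>\<^sub>F j in sequentially. mersenne_length j / real j \<le> (log 2 (real (Suc j)) + 2) / real j"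
    by (intro always_eventually allI divide_right_mono mersenne_length_le_log) auto
  show "(\<lambda>j. (log 2 (real (Suc j)) + 2) / real j) \<longlonglongrightarrow> 0"
    by real_asymp
qed (auto intro!: tendsto_const)

text \<open>The length enters the roots below as \<open>(\<rho> + 1) powr (d j / j)\<close> and disappears in the limit.\<close>

lemma outer_radius:
  "(\<lambda>j. mersenne_weight \<rho> (int j) powr (1 / real j)) \<longlonglongrightarrow> \<rho>"
proof -
  have "(\<lambda>j. \<rho> * (\<rho> + 1) powr (mersenne_length j / real j)) \<longlonglongrightarrow> \<rho> * (\<rho> + 1) powr 0"
    using rho by (intro tendsto_intros mersenne_length_sublinear) auto
  moreover have "\<forall>\<^sub>F j in sequentially. \<rho> * (\<rho> + 1) powr (mersenne_length j / real j)
      = mersenne_weight \<rho> (int j) powr (1 / real j)"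
    using eventually_gt_at_top[of 0]
  proof eventually_elim
    case (elim j)
    have "(\<rho> ^ j) powr (1 / real j) = \<rho>"
      using rho elim by (simp add: powr_realpow[symmetric] powr_powr)
    moreover have "((\<rho> + 1) ^ mersenne_length j) powr (1 / real j)
        = (\<rho> + 1) powr (mersenne_length j / real j)"
      using rho by (simp add: powr_realpow[symmetric] powr_powr)
    ultimately show ?case
      using rho by (simp add: mersenne_weight_nonneg_arg powr_mult)
  qed
  ultimately show ?thesis
    using rho by (simp add: filterlim_cong)
qed

lemma inner_radius:
  "(\<lambda>j. mersenne_weight \<rho> (- int j) powr (- 1 / real j)) \<longlonglongrightarrow> 1 / (\<rho> * (\<rho> + 1))"
proof -
  have "(\<lambda>j. inverse \<rho> * (\<rho> + 1) powr (- (mersenne_length j / real j + 1)))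
      \<longlonglongrightarrow> inverse \<rho> * (\<rho> + 1) powr (- (0 + 1))"
    using rho by (intro tendsto_intros mersenne_length_sublinear) auto
  moreover have "\<forall>\<^sub>F j in sequentially.
      inverse \<rho> * (\<rho> + 1) powr (- (mersenne_length j / real j + 1))
      = mersenne_weight \<rho> (- int j) powr (- 1 / real j)"
    using eventually_gt_at_top[of 0]
  proof eventually_elim
    case (elim j)
    have "(\<rho> ^ j) powr (- 1 / real j) = inverse \<rho>"
      using rho elim by (simp add: powr_realpow[symmetric] powr_powr powr_minus)
    moreover have "((\<rho> + 1) ^ (mersenne_length j + j)) powr (- 1 / real j)
        = (\<rho> + 1) powr (- (mersenne_length j / real j + 1))"
      using rho elim by (simp add: powr_realpow[symmetric] powr_powr add_divide_distrib)
    ultimately show ?case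
      using rho by (simp only: mersenne_weight_nonpos_arg) (simp add: powr_mult)
  qed
  ultimately have "(\<lambda>j. mersenne_weight \<rho> (- int j) powr (- 1 / real j))
      \<longlonglongrightarrow> inverse \<rho> * (\<rho> + 1) powr (- (0 + 1))"
    by (rule Lim_transform_eventually)
  then show ?thesis
    using rho by (simp add: powr_minus divide_simps)
qed

end

section \<open>The recursively defined weight\<close>

text \<open>The initial values at \<open>1\<close> and \<open>2\<close> are those which the recursion would give for \<open>k = 1\<close>.\<close>

lemma recursion_eq_power_mersenne_length:
  fixes \<gamma> :: "int \<Rightarrow> real"
  assumes "\<gamma> 0 = 1" "\<gamma> 1 = c" "\<gamma> 2 = c\<^sup>2"
    and rec: "\<And>k j. k \<ge> 2 \<Longrightarrow> 2 ^ k - 1 \<le> j \<Longrightarrow> j < 2 ^ (k + 1) - 1 \<Longrightarrow> \<gamma> j = c * \<gamma> (j - (2 ^ k - 1))"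
  shows "\<gamma> (int j) = c ^ mersenne_length j"
proof (induction j rule: less_induct)
  case (less j)
  show ?case
  proof (cases "j = 0")
    case False
    then obtain k b where kb: "1 \<le> k" "b < 2 ^ k" "j = b + (2 ^ k - 1)"
      using mersenne_decomp by blast
    have len: "mersenne_length j = Suc (mersenne_length b)"
      using mersenne_length_step kb by simp
    show ?thesis
    proof (cases "k = 1")
      case True
      have "mersenne_length 1 = 1"
        using mersenne_length_mersenne[of 1] by simp
      then show ?thesis
        using True kb len assms(1-3) by (cases "b = 0") (auto simp: less_2_cases_iff power2_eq_square)
    next
      case k: False
      have pw: "(2::nat) ^ 1 \<le> 2 ^ k" using kb by (intro power_increasing) auto
      have j: "int j = int b + (2 ^ k - 1)" using kb pw by (simp add: of_nat_diff)
      have "int b < 2 ^ k" using kb(2) by (metis of_nat_less_iff of_nat_numeral of_nat_power)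
      then have "\<gamma> (int j) = c * \<gamma> (int j - (2 ^ k - 1))"
        using j k kb(1) by (intro rec) auto
      moreover have "b < j" using kb pw by simp
      ultimately show ?thesis
        using less.IH[of b] j len by simp
    qed
  qed (simp add: assms)
qed

theorem theorem7p6:
  fixes \<rho> :: real and n :: "nat \<Rightarrow> int" and \<gamma> \<omega> :: "int \<Rightarrow> real"
  assumes "\<rho> > 1"
    and "\<And>k. k \<ge> 1 \<Longrightarrow> n k = 2 ^ k - 1"
    and "\<gamma> 0 = 1"
    and "\<gamma> 1 = \<rho> + 1"
    and "\<gamma> 2 = (\<rho> + 1)\<^sup>2"
    and "\<gamma> 3 = \<rho> + 1"
    and "\<And>k j. k \<ge> 2 \<Longrightarrow> n k \<le> j \<Longrightarrow> j < n (k + 1) \<Longrightarrow> \<gamma> j = (\<rho> + 1) * \<gamma> (j - n k)"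
    and "\<And>m :: nat. m \<ge> 1 \<Longrightarrow> \<gamma> (- int m) = (\<rho> + 1) ^ m * \<gamma> (int m)"
    and "\<And>m. \<omega> m = \<rho> ^ nat \<bar>m\<bar> * \<gamma> m"
  shows "is_weight \<omega>
    \<and> \<not> finitely_generated_ideal \<omega> (augmentation_ideal \<omega>)
    \<and> (\<exists>\<phi> \<in> character_space \<omega>.
          \<phi> (point_mass 1) = 1 \<and> augmentation_ideal \<omega> = {f \<in> ell1 \<omega>. \<phi> f = 0})
    \<and> 1 \<in> interior ((\<lambda>\<phi>. \<phi> (point_mass 1)) ` character_space \<omega>)
    \<and> (\<exists>\<rho>\<^sub>1 \<rho>\<^sub>2.
          (\<lambda>m. \<omega> (- int m) powr (- 1 / real m)) \<longlonglongrightarrow> \<rho>\<^sub>1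
        \<and> (\<lambda>m. \<omega> (int m) powr (1 / real m)) \<longlonglongrightarrow> \<rho>\<^sub>2
        \<and> 1 \<in> interior (annulus \<rho>\<^sub>1 \<rho>\<^sub>2))"
proof -
  have "\<gamma> j = (\<rho> + 1) * \<gamma> (j - (2 ^ k - 1))"
    if "k \<ge> 2" "2 ^ k - 1 \<le> j" "j < 2 ^ (k + 1) - 1" for k j
    using assms(7)[of k j] assms(2)[of k] assms(2)[of "k + 1"] that by simp
  from recursion_eq_power_mersenne_length[OF assms(3-5) this]
  have gamma: "\<gamma> (int j) = (\<rho> + 1) ^ mersenne_length j" for j .
  have "\<omega> m = mersenne_weight \<rho> m" for m
  proof (cases m rule: int_cases2)
    case (nonneg j)
    then show ?thesis by (simp add: assms(9) gamma mersenne_weight_nonneg_arg)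
  next
    case (nonpos j)
    have "\<gamma> (- int j) = (\<rho> + 1) ^ (mersenne_length j + j)"
      using assms(8)[of j] by (cases "j = 0") (simp_all add: assms(3) gamma power_add)
    then show ?thesis
      using nonpos by (simp add: assms(9) mersenne_weight_nonpos_arg)
  qed
  then have \<omega>: "\<omega> = mersenne_weight \<rho>" by auto
  have one: "1 \<in> annulus (1 / (\<rho> * (\<rho> + 1))) \<rho>"
    using one_in_interior_annulus[OF assms(1) order_refl] interior_subset by blast
  let ?\<phi> = "evaluation (mersenne_weight \<rho>)"
  have character: "?\<phi> z \<in> character_space (mersenne_weight \<rho>)"
    if "z \<in> annulus (1 / (\<rho> * (\<rho> + 1))) \<rho>" for z
    using that evaluation_in_mersenne_character_space[OF assms(1)] by (simp add: annulus_def)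
  have "annulus (1 / (\<rho> * (\<rho> + 1))) \<rho>
      \<subseteq> (\<lambda>\<phi>. \<phi> (point_mass 1)) ` character_space (mersenne_weight \<rho>)"
  proof
    fix z
    assume z: "z \<in> annulus (1 / (\<rho> * (\<rho> + 1))) \<rho>"
    have "z = ?\<phi> z (point_mass 1)"
      by (simp add: evaluation_point_mass)
    then show "z \<in> (\<lambda>\<phi>. \<phi> (point_mass 1)) ` character_space (mersenne_weight \<rho>)"
      by (rule image_eqI[OF _ character[OF z]])
  qed
  note interior = one_in_interior_annulus[OF assms(1) this]
  show ?thesis
    unfolding \<omega>
  proof (intro conjI)
    show "\<exists>\<phi>\<in>character_space (mersenne_weight \<rho>). \<phi> (point_mass 1) = 1 \<and>
        augmentation_ideal (mersenne_weight \<rho>) = {f \<in> ell1 (mersenne_weight \<rho>). \<phi> f = 0}"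
      by (rule bexI[OF _ character[OF one]])
         (simp add: evaluation_point_mass augmentation_ideal_eq_kernel)
    show "\<exists>\<rho>\<^sub>1 \<rho>\<^sub>2.
          (\<lambda>m. mersenne_weight \<rho> (- int m) powr (- 1 / real m)) \<longlonglongrightarrow> \<rho>\<^sub>1
        \<and> (\<lambda>m. mersenne_weight \<rho> (int m) powr (1 / real m)) \<longlonglongrightarrow> \<rho>\<^sub>2
        \<and> 1 \<in> interior (annulus \<rho>\<^sub>1 \<rho>\<^sub>2)"
      using inner_radius[OF assms(1)] outer_radius[OF assms(1)]
        one_in_interior_annulus[OF assms(1) order_refl] by blast
  qed (fact is_weight_mersenne_weight[OF assms(1)]
        mersenne_weight_not_finitely_generated[OF assms(1)] interior)+
qed

end
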